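(* Let $T=(T_{ijkl})_{i,j,k,l=1}^3$ be a real rank-four tensor with linear elastic cubic symmetry, and let $f\colon\mathbb R^{3\times 3}\to\mathbb R$ be the associated quadratic form $f(\xi)=\sum_{i,j,k,l=1}^3 T_{ijkl}\,\xi_{ij}\xi_{kl}$, $\xi=(\xi_{ij})_{i,j=1}^3$. If $f$ is quasiconvex, then $f$ can be written as a sum of a convex quadratic form and a null-Lagrangian quadratic form on $\mathbb R^{3\times 3}$.
   Context: A rank-four tensor $T$ has linear elastic cubic symmetry if there are real numbers $\alpha,\beta,\gamma$ such that $T_{iiii}=\alpha$ for all $i$; $T_{iijj}=\beta$ for all $i\neq j$; $T_{ijij}=T_{ijji}=\gamma$ for all $i\ne j$; and all other entries of $T$ vanish. For $x,y\in\mathbb R^3$, $x\otimes y$ denotes the matrix with entries $(x\otimes y)_{ij}=x_iy_j$. A quadratic form $f$ on $\mathbb R^{3\times3}$ is quasiconvex if and only if $f(x\otimes y)\ge 0$ for all $x,y\in\mathbb R^3$ (for quadratic forms this is equivalent to Morrey's quasiconvexity and to rank-one convexity). A null-Lagrangian quadratic form is a linear combination of the nine $2\times 2$ minors of $\xi$ (equivalently, a quadratic form vanishing on all matrices $x\otimes y$). *)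

theory Defs
  imports "HOL-Analysis.Analysis"
begin

type_synonym mat3 = "real^3^3"
type_synonym tensor4 = "real^3^3^3^3"

text \<open>The index set is the type \<open>3\<close>, whose three elements are \<open>1\<close>, \<open>2\<close> and \<open>3\<close>
  (the last one being equal to \<open>0\<close>).\<close>

definition quad_form :: "tensor4 \<Rightarrow> mat3 \<Rightarrow> real" where
  "quad_form T \<xi> =
     (\<Sum>i\<in>UNIV. \<Sum>j\<in>UNIV. \<Sum>k\<in>UNIV. \<Sum>l\<in>UNIV. T$i$j$k$l * \<xi>$i$j * \<xi>$k$l)"

definition quadratic_form :: "(mat3 \<Rightarrow> real) \<Rightarrow> bool" where
  "quadratic_form f \<longleftrightarrow> (\<exists>C. f = quad_form C)"

definition cubic_symmetry :: "tensor4 \<Rightarrow> bool" where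
  "cubic_symmetry T \<longleftrightarrow>
     (\<exists>\<alpha> \<beta> \<gamma>.
        (\<forall>i. T$i$i$i$i = \<alpha>) \<and>
        (\<forall>i j. i \<noteq> j \<longrightarrow> T$i$i$j$j = \<beta>) \<and>
        (\<forall>i j. i \<noteq> j \<longrightarrow> T$i$j$i$j = \<gamma> \<and> T$i$j$j$i = \<gamma>) \<and>
        (\<forall>i j k l. \<not> (i = j \<and> k = l) \<and> \<not> (i = k \<and> j = l) \<and> \<not> (i = l \<and> j = k)
            \<longrightarrow> T$i$j$k$l = 0))"

definition tensor_prod :: "real^3 \<Rightarrow> real^3 \<Rightarrow> mat3" where
  "tensor_prod x y = (\<chi> i j. x$i * y$j)"

text \<open>For quadratic forms, Morrey's quasiconvexity amounts to nonnegativity on the matrices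
  \<open>x \<otimes> y\<close>; this is taken as the definition.\<close>

definition quasiconvex_form :: "(mat3 \<Rightarrow> real) \<Rightarrow> bool" where
  "quasiconvex_form f \<longleftrightarrow> quadratic_form f \<and> (\<forall>x y. f (tensor_prod x y) \<ge> 0)"

definition index_pairs :: "(3 \<times> 3) set" where
  "index_pairs = {(1, 2), (1, 3), (2, 3)}"

text \<open>The \<open>2 \<times> 2\<close> minor of \<open>\<xi>\<close> with rows \<open>i, k\<close> and columns \<open>j, l\<close>.\<close>

definition minor2 :: "3 \<times> 3 \<Rightarrow> 3 \<times> 3 \<Rightarrow> mat3 \<Rightarrow> real" where
  "minor2 = (\<lambda>(i, k) (j, l) \<xi>. \<xi>$i$j * \<xi>$k$l - \<xi>$i$l * \<xi>$k$j)"

definition null_lagrangian_form :: "(mat3 \<Rightarrow> real) \<Rightarrow> bool" where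
  "null_lagrangian_form h \<longleftrightarrow>
     (\<exists>c. \<forall>\<xi>. h \<xi> = (\<Sum>r\<in>index_pairs. \<Sum>s\<in>index_pairs. c r s * minor2 r s \<xi>))"

end

theory Submission
  imports Defs
begin

text \<open>A cubic form is
  \<open>f \<xi> = \<alpha> \<Sum>\<^sub>i \<xi>\<^sub>i\<^sub>i\<^sup>2 + 2\<beta> \<Sum>\<^sub>i\<^sub><\<^sub>j \<xi>\<^sub>i\<^sub>i \<xi>\<^sub>j\<^sub>j + \<gamma> \<Sum>\<^sub>i\<^sub><\<^sub>j (\<xi>\<^sub>i\<^sub>j + \<xi>\<^sub>j\<^sub>i)\<^sup>2\<close>. Subtracting \<open>2c\<close> times the sum of
  the three principal minors leaves a form that splits into a diagonal block with eigenvalues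
  \<open>\<alpha> - \<beta> + c\<close> and \<open>\<alpha> + 2(\<beta> - c)\<close>, and three off-diagonal blocks with eigenvalues \<open>2\<gamma> + c\<close> and \<open>-c\<close>.
  A constant \<open>c\<close> making all of them nonnegative exists if and only if
  \<open>\<alpha> \<ge> 0\<close>, \<open>\<gamma> \<ge> 0\<close>, \<open>\<alpha> \<ge> \<beta>\<close> and \<open>\<alpha> + 2\<beta> + 4\<gamma> \<ge> 0\<close>; these four inequalities come from testing \<open>f\<close> on
  \<open>e\<^sub>1 \<otimes> e\<^sub>1\<close>, \<open>e\<^sub>1 \<otimes> e\<^sub>2\<close>, \<open>(1, 1, 0) \<otimes> (1, -1, 0)\<close> and \<open>(1, 1, 1) \<otimes> (1, 1, 1)\<close>.\<close>

text \<open>Holds already summand by summand; it reduces convexity of a quadratic form to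
  nonnegativity.\<close>

lemma quad_form_convex_combination:
  "u * quad_form C x + (1 - u) * quad_form C y - quad_form C (u *\<^sub>R x + (1 - u) *\<^sub>R y)
     = u * (1 - u) * quad_form C (x - y)"
  unfolding quad_form_def sum_distrib_left sum.distrib[symmetric] sum_subtractf[symmetric]
  by (intro sum.cong refl) (simp add: algebra_simps)

lemma convex_on_quad_form:
  assumes "\<And>\<xi>. quad_form C \<xi> \<ge> 0"
  shows "convex_on UNIV (quad_form C)"
proof (rule convex_onI)
  fix t :: real and x y :: mat3
  assume "0 < t" "t < 1"
  then have "(1 - t) * t * quad_form C (x - y) \<ge> 0"
    using assms by simp
  then show "quad_form C ((1 - t) *\<^sub>R x + t *\<^sub>R y) \<le> (1 - t) * quad_form C x + t * quad_form C y"
    using quad_form_convex_combination[of "1 - t" C x y] by simp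
qed simp

lemma cubic_quad_form:
  assumes "cubic_symmetry T"
  obtains \<alpha> \<beta> \<gamma> where
    "\<And>\<xi>. quad_form T \<xi> =
      \<alpha> * ((\<xi>$1$1)\<^sup>2 + (\<xi>$2$2)\<^sup>2 + (\<xi>$3$3)\<^sup>2)
      + 2 * \<beta> * (\<xi>$1$1 * \<xi>$2$2 + \<xi>$1$1 * \<xi>$3$3 + \<xi>$2$2 * \<xi>$3$3)
      + \<gamma> * ((\<xi>$1$2 + \<xi>$2$1)\<^sup>2 + (\<xi>$1$3 + \<xi>$3$1)\<^sup>2 + (\<xi>$2$3 + \<xi>$3$2)\<^sup>2)"
proof -
  obtain \<alpha> \<beta> \<gamma> where T:
    "\<And>i. T$i$i$i$i = \<alpha>"
    "\<And>i j. i \<noteq> j \<Longrightarrow> T$i$i$j$j = \<beta>"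
    "\<And>i j. i \<noteq> j \<Longrightarrow> T$i$j$i$j = \<gamma>"
    "\<And>i j. i \<noteq> j \<Longrightarrow> T$i$j$j$i = \<gamma>"
    "\<And>i j k l. \<not> (i = j \<and> k = l) \<Longrightarrow> \<not> (i = k \<and> j = l) \<Longrightarrow> \<not> (i = l \<and> j = k)
       \<Longrightarrow> T$i$j$k$l = 0"
    using assms unfolding cubic_symmetry_def by metis
  show thesis
    by (rule that[of \<alpha> \<beta> \<gamma>])
      (simp add: quad_form_def sum_3 T, simp add: algebra_simps power2_eq_square)
qed

text \<open>The associated form is (tr \<xi>)^2 - tr(\<xi>^2), twice the second invariant of
  \<xi>.\<close>

definition trace_minor_tensor :: tensor4 where
  "trace_minor_tensor = (\<chi> i j k l. of_bool (i = j \<and> k = l) - of_bool (i = l \<and> j = k))"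

lemma quad_form_trace_minor_tensor:
  "quad_form trace_minor_tensor \<xi> =
     2 * (minor2 (1, 2) (1, 2) \<xi> + minor2 (1, 3) (1, 3) \<xi> + minor2 (2, 3) (2, 3) \<xi>)"
  by (simp add: quad_form_def sum_3 trace_minor_tensor_def minor2_def)

lemma quad_form_diff_scaleR:
  "quad_form (T - c *\<^sub>R N) \<xi> = quad_form T \<xi> - c * quad_form N \<xi>"
  unfolding quad_form_def sum_distrib_left sum_subtractf[symmetric]
  by (intro sum.cong refl) (simp add: algebra_simps)

lemma null_lagrangian_trace_minor:
  "null_lagrangian_form (\<lambda>\<xi>. c * quad_form trace_minor_tensor \<xi>)"
  unfolding null_lagrangian_form_def
  by (rule exI[of _ "\<lambda>r s. 2 * c * of_bool (r = s)"])
    (simp add: quad_form_trace_minor_tensor index_pairs_def algebra_simps)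

theorem theorem1p4:
  fixes T :: tensor4 and f :: "mat3 \<Rightarrow> real"
  assumes "cubic_symmetry T"
    and "f = quad_form T"
    and "quasiconvex_form f"
  shows "\<exists>g h. quadratic_form g \<and> convex_on UNIV g \<and> null_lagrangian_form h \<and>
               (\<forall>\<xi>. f \<xi> = g \<xi> + h \<xi>)"
proof -
  obtain \<alpha> \<beta> \<gamma> where f:
    "\<And>\<xi>. quad_form T \<xi> =
      \<alpha> * ((\<xi>$1$1)\<^sup>2 + (\<xi>$2$2)\<^sup>2 + (\<xi>$3$3)\<^sup>2)
      + 2 * \<beta> * (\<xi>$1$1 * \<xi>$2$2 + \<xi>$1$1 * \<xi>$3$3 + \<xi>$2$2 * \<xi>$3$3)
      + \<gamma> * ((\<xi>$1$2 + \<xi>$2$1)\<^sup>2 + (\<xi>$1$3 + \<xi>$3$1)\<^sup>2 + (\<xi>$2$3 + \<xi>$3$2)\<^sup>2)"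
    using cubic_quad_form[OF assms(1)] by blast
  have nonneg: "quad_form T (tensor_prod x y) \<ge> 0" for x y
    using assms(2,3) by (simp add: quasiconvex_form_def)
  have ineqs: "\<alpha> \<ge> 0" "\<gamma> \<ge> 0" "\<alpha> \<ge> \<beta>" "\<alpha> + 2 * \<beta> + 4 * \<gamma> \<ge> 0"
    using nonneg[of "vector [1, 0, 0]" "vector [1, 0, 0]"]
      nonneg[of "vector [1, 0, 0]" "vector [0, 1, 0]"]
      nonneg[of "vector [1, 1, 0]" "vector [1, -1, 0]"]
      nonneg[of "vector [1, 1, 1]" "vector [1, 1, 1]"]
    by (simp_all add: f tensor_prod_def vector_3)
  \<comment> \<open>The eigenvalue conditions bound \<open>c\<close> below by these two numbers and
    above by 0 and (\<alpha> + 2\<beta>)/2; the least candidate is taken.\<close>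
  define c where "c = max (- 2 * \<gamma>) (\<beta> - \<alpha>)"
  have c: "\<alpha> - \<beta> + c \<ge> 0" "\<alpha> + 2 * (\<beta> - c) \<ge> 0" "2 * \<gamma> + c \<ge> 0" "- c \<ge> 0"
    using ineqs by (auto simp: c_def max_def)
  define C where "C = T - c *\<^sub>R trace_minor_tensor"
  \<comment> \<open>Spectral decomposition: trace, trace-free diagonal, symmetric and skew
    off-diagonal parts.\<close>
  have "quad_form C \<xi> =
      (\<alpha> + 2 * (\<beta> - c)) / 3 * (\<xi>$1$1 + \<xi>$2$2 + \<xi>$3$3)\<^sup>2
      + (\<alpha> - \<beta> + c) / 3 * ((\<xi>$1$1 - \<xi>$2$2)\<^sup>2 + (\<xi>$1$1 - \<xi>$3$3)\<^sup>2 + (\<xi>$2$2 - \<xi>$3$3)\<^sup>2)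
      + (2 * \<gamma> + c) / 2 * ((\<xi>$1$2 + \<xi>$2$1)\<^sup>2 + (\<xi>$1$3 + \<xi>$3$1)\<^sup>2 + (\<xi>$2$3 + \<xi>$3$2)\<^sup>2)
      + - c / 2 * ((\<xi>$1$2 - \<xi>$2$1)\<^sup>2 + (\<xi>$1$3 - \<xi>$3$1)\<^sup>2 + (\<xi>$2$3 - \<xi>$3$2)\<^sup>2)" for \<xi>
    unfolding C_def quad_form_diff_scaleR f quad_form_trace_minor_tensor
    by (simp add: minor2_def) (simp add: field_simps power2_eq_square)
  then have "quad_form C \<xi> \<ge> 0" for \<xi>
    using c by (simp only:) (intro add_nonneg_nonneg mult_nonneg_nonneg; simp)
  then have "convex_on UNIV (quad_form C)"
    by (rule convex_on_quad_form)
  moreover have "quadratic_form (quad_form C)"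
    by (auto simp: quadratic_form_def)
  moreover have "f \<xi> = quad_form C \<xi> + c * quad_form trace_minor_tensor \<xi>" for \<xi>
    by (simp add: assms(2) C_def quad_form_diff_scaleR)
  ultimately show ?thesis
    using null_lagrangian_trace_minor by blast
qed

end
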